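(* Let $b_1,\dots,b_m$ be real numbers and let $\alpha_1,\dots,\alpha_m$ be real numbers such that their $\mathbb{Q}$-span (the $\mathbb{Q}$-linear subspace of $\mathbb{R}$ spanned by $\alpha_1,\dots,\alpha_m$) does not contain $1$. Then $c_S=c_T$, where $$c_S=-\inf_{k\in\mathbb{Z}}\sum_{j=1}^m b_j\cos(2\pi\alpha_jk),\qquad c_T=-\inf_{t\in\mathbb{R}}\sum_{j=1}^m b_j\cos(2\pi\alpha_jt).$$
   Context: $m$ is a positive integer. *)

theory Defs
  imports "HOL-Analysis.Analysis"
begin

text \<open>The class-based \<open>span\<close> on \<^typ>\<open>real\<close> is the span over the reals, so the
  rational span is the locale version of \<open>span\<close> for the scaling of reals by rationals.\<close>

definition rat_scale :: "rat \<Rightarrow> real \<Rightarrow> real"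
  where "rat_scale q x = of_rat q * x"

lemma vector_space_rat_scale: "vector_space rat_scale"
  by unfold_locales (simp_all add: rat_scale_def of_rat_add of_rat_mult algebra_simps)

definition rat_span :: "real set \<Rightarrow> real set"
  where "rat_span = module.span rat_scale"

definition cos_sum :: "nat \<Rightarrow> (nat \<Rightarrow> real) \<Rightarrow> (nat \<Rightarrow> real) \<Rightarrow> real \<Rightarrow> real"
  where "cos_sum m b \<alpha> t = (\<Sum>j=1..m. b j * cos (2 * pi * \<alpha> j * t))"

lemma cos_sum_lower_bound: "- (\<Sum>j=1..m. \<bar>b j\<bar>) \<le> cos_sum m b \<alpha> t"
proof -
  have "- \<bar>b j\<bar> \<le> b j * cos (2 * pi * \<alpha> j * t)" for j
    using mult_left_le[OF abs_cos_le_one[of "2 * pi * \<alpha> j * t"] abs_ge_zero[of "b j"]]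
    by (simp add: abs_mult[symmetric])
  then show ?thesis
    by (simp add: cos_sum_def sum_negf[symmetric] sum_mono)
qed

text \<open>By the bound above, both infima are taken over nonempty sets bounded below, where the
  conditionally complete infimum on \<^typ>\<open>real\<close> is the true one.\<close>

definition c_S :: "nat \<Rightarrow> (nat \<Rightarrow> real) \<Rightarrow> (nat \<Rightarrow> real) \<Rightarrow> real"
  where "c_S m b \<alpha> = - (INF k::int. cos_sum m b \<alpha> (of_int k))"

definition c_T :: "nat \<Rightarrow> (nat \<Rightarrow> real) \<Rightarrow> (nat \<Rightarrow> real) \<Rightarrow> real"
  where "c_T m b \<alpha> = - (INF t::real. cos_sum m b \<alpha> t)"

end

theory Submission
  imports Defs
begin

text \<open>
  The integers sample the real orbit of \<open>(\<alpha>\<^sub>1, \<dots>, \<alpha>\<^sub>m)\<close> on the torus densely. Given a real \<open>t\<close>, it is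
  enough to find integers \<open>k\<close> for which every \<open>(k - t) \<alpha>\<^sub>j\<close> is as close to an integer as desired: the
  cosine sum at \<open>k\<close> is then close to the one at \<open>t\<close>, so the infimum over \<open>\<int>\<close> cannot exceed the
  infimum over \<open>\<real>\<close>.

  Such \<open>k\<close> come from Kronecker's theorem, which needs numbers that are linearly independent over
  \<open>\<int>\<close> together with \<open>1\<close>. The \<open>\<alpha>\<^sub>j\<close> themselves may well be dependent, so they are replaced by a
  \<open>\<rat>\<close>-basis \<open>B\<close> chosen among them; adding \<open>1\<close> keeps it independent precisely because \<open>1\<close> is not in
  the span. Let \<open>D\<close> be a common denominator of the coordinates of the \<open>\<alpha>\<^sub>j\<close> in this basis. If \<open>k v\<close> is
  close to \<open>t v / D\<close> modulo \<open>1\<close> for each \<open>v \<in> B\<close>, then multiplying by the integers \<open>D q\<close>, where \<open>q\<close>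
  runs through the coordinates of \<open>\<alpha>\<^sub>j\<close>, and adding up shows that \<open>(D k) \<alpha>\<^sub>j\<close> is close to \<open>t \<alpha>\<^sub>j\<close> modulo
  \<open>1\<close>.
\<close>

interpretation rat_real: vector_space rat_scale
  by (rule vector_space_rat_scale)

interpretation int_real: module "\<lambda>r x. real_of_int r * x"
  by unfold_locales (simp_all add: algebra_simps)

lemma rat_independent_imp_int_independent:
  assumes "rat_real.independent S"
  shows "int_real.independent S"
proof
  assume "int_real.dependent S"
  then obtain T u v where T: "finite T" "T \<subseteq> S" "(\<Sum>x\<in>T. real_of_int (u x) * x) = 0"
    and v: "v \<in> T" "u v \<noteq> 0"
    by (auto simp: int_real.dependent_explicit)
  then have "(\<Sum>x\<in>T. rat_scale (of_int (u x)) x) = 0"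
    by (simp add: rat_scale_def)
  from rat_real.independentD[OF assms T(1,2) this v(1)] v(2) show False
    by simp
qed

lemma common_denominator:
  fixes Q :: "rat set"
  assumes "finite Q"
  shows "\<exists>D::int. D > 0 \<and> (\<forall>q\<in>Q. of_int D * q \<in> \<int>)"
  using assms
proof induction
  case empty
  show ?case by (auto intro: exI[of _ 1])
next
  case (insert q Q)
  then obtain D :: int where D: "D > 0" "\<forall>q\<in>Q. of_int D * q \<in> \<int>"
    by blast
  obtain a d where q: "quotient_of q = (a, d)"
    by fastforce
  then have d: "d > 0" "q = of_int a / of_int d"
    using quotient_of_denom_pos quotient_of_div by blast+
  have "of_int (d * D) * r \<in> \<int>" if "r \<in> insert q Q" for r
  proof (cases "r = q")
    case True
    then have "of_int (d * D) * r = of_int (D * a)"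
      using d by simp
    then show ?thesis by (metis Ints_of_int)
  next
    case False
    with that D(2) have "of_int D * r \<in> \<int>"
      by blast
    then have "of_int d * (of_int D * r) \<in> \<int>"
      by (rule Ints_mult[OF Ints_of_int])
    then show ?thesis by (simp only: of_int_mult mult.assoc)
  qed
  with D d show ?case
    by (intro exI[of _ "d * D"]) auto
qed

text \<open>Kronecker's theorem for a finite set of numbers in place of an enumerated family.\<close>

lemma Kronecker_finite_set:
  fixes B :: "real set" and g :: "real \<Rightarrow> real"
  assumes "finite B" "1 \<notin> B" "int_real.independent (insert 1 B)" "\<epsilon> > 0"
  obtains k :: int and h :: "real \<Rightarrow> int"
  where "\<And>v. v \<in> B \<Longrightarrow> \<bar>of_int k * v - of_int (h v) - g v\<bar> < \<epsilon>"
proof -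
  define n where "n = card B"
  obtain e where e: "bij_betw e {..<n} B"
    using ex_bij_betw_nat_finite[OF assms(1)] by (auto simp: n_def atLeast0LessThan)
  define \<theta> where "\<theta> = e(n := 1)"
  have im: "\<theta> ` {..n} = insert 1 B"
    using e by (auto simp: \<theta>_def bij_betw_def lessThan_Suc_atMost[symmetric] lessThan_Suc image_iff)
  have "card (\<theta> ` {..n}) = card {..n}"
    unfolding im using assms(1,2) by (simp add: n_def)
  then have inj: "inj_on \<theta> {..n}"
    by (intro eq_card_imp_inj_on) auto
  obtain k p where kp: "\<And>i. i < n \<Longrightarrow> \<bar>of_int k * \<theta> i - of_int (p i) - g (e i)\<bar> < \<epsilon>"
  proof (rule Kronecker_thm_2[of \<theta> n \<epsilon> "\<lambda>i. g (e i)"])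
    show "int_real.independent (\<theta> ` {..n})"
      unfolding im by (rule assms(3))
  qed (use inj assms(4) in \<open>auto simp: \<theta>_def\<close>)
  show thesis
  proof
    fix v assume "v \<in> B"
    then obtain i where "i < n" "v = e i"
      using e by (auto simp: bij_betw_def)
    moreover have "inv_into {..<n} e (e i) = i"
      using \<open>i < n\<close> e by (auto simp: bij_betw_def)
    ultimately show "\<bar>of_int k * v - of_int ((p \<circ> inv_into {..<n} e) v) - g v\<bar> < \<epsilon>"
      using kp[of i] by (simp add: \<theta>_def)
  qed
qed

text \<open>Integer multiples of finitely many numbers approximate, modulo \<open>1\<close>, their common multiple by any
  real \<open>t\<close>. Rational relations among the numbers do no harm, because they are respected by the
  targets \<open>t * a\<close>; only a relation involving \<open>1\<close> would be an obstruction.\<close>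

lemma integer_multiples_approximate_real_multiples:
  fixes A :: "real set" and t \<epsilon> :: real
  assumes "finite A" "1 \<notin> rat_span A" "\<epsilon> > 0"
  shows "\<exists>k::int. \<forall>a\<in>A. \<exists>h::int. \<bar>of_int k * a - of_int h - t * a\<bar> < \<epsilon>"
proof -
  obtain B where B: "B \<subseteq> A" "rat_real.independent B" "A \<subseteq> rat_real.span B"
    by (rule rat_real.maximal_independent_subset)
  have fin: "finite B"
    using B(1) assms(1) finite_subset by blast
  have one: "1 \<notin> rat_real.span B"
    using assms(2) rat_real.span_mono[OF B(1)] by (auto simp: rat_span_def)
  then have indep: "int_real.independent (insert 1 B)"
    using B(2) by (intro rat_independent_imp_int_independent rat_real.independent_insertI)
  have "\<exists>u. a = (\<Sum>v\<in>B. of_rat (u v) * v)" if "a \<in> A" for a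
    using that B(3) by (auto simp: rat_real.span_finite[OF fin] rat_scale_def)
  then obtain u where u: "\<And>a. a \<in> A \<Longrightarrow> a = (\<Sum>v\<in>B. of_rat (u a v) * v)"
    by metis
  obtain D :: int where D: "D > 0" "\<And>a v. a \<in> A \<Longrightarrow> v \<in> B \<Longrightarrow> of_int D * u a v \<in> \<int>"
    using common_denominator[of "(\<lambda>(a, v). u a v) ` (A \<times> B)"] assms(1) fin by auto
  then obtain N :: "real \<Rightarrow> real \<Rightarrow> int"
    where N: "\<And>a v. a \<in> A \<Longrightarrow> v \<in> B \<Longrightarrow> of_int D * u a v = of_int (N a v)"
    unfolding Ints_def image_iff by (metis (no_types, lifting))
  have Da: "of_int D * a = (\<Sum>v\<in>B. of_int (N a v) * v)" if "a \<in> A" for a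
  proof -
    have "of_int D * a = of_int D * (\<Sum>v\<in>B. of_rat (u a v) * v)"
      using u[OF that] by simp
    also have "\<dots> = (\<Sum>v\<in>B. of_rat (of_int D * u a v) * v)"
      by (simp add: sum_distrib_left of_rat_mult mult.assoc)
    also have "\<dots> = (\<Sum>v\<in>B. of_int (N a v) * v)"
      using that by (intro sum.cong) (simp_all add: N)
    finally show ?thesis .
  qed
  \<comment> \<open>One tolerance for all basis elements: the error at \<open>a\<close> is at most
    \<open>\<delta> * (\<Sum>v\<in>B. \<bar>N a v\<bar>)\<close>, and \<open>M\<close> exceeds each of these sums.\<close>
  define M :: real where "M = 1 + (\<Sum>a\<in>A. \<Sum>v\<in>B. \<bar>of_int (N a v)\<bar>)"
  have M: "M > 0" "\<And>a. a \<in> A \<Longrightarrow> (\<Sum>v\<in>B. \<bar>real_of_int (N a v)\<bar>) < M"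
  proof -
    show "M > 0"
      by (auto simp: M_def intro!: add_pos_nonneg sum_nonneg)
    fix a assume "a \<in> A"
    then have "(\<Sum>v\<in>B. \<bar>real_of_int (N a v)\<bar>) \<le> (\<Sum>a\<in>A. \<Sum>v\<in>B. \<bar>of_int (N a v)\<bar>)"
      using assms(1) by (intro member_le_sum) (auto intro: sum_nonneg)
    then show "(\<Sum>v\<in>B. \<bar>real_of_int (N a v)\<bar>) < M"
      by (simp add: M_def)
  qed
  define \<delta> where "\<delta> = \<epsilon> / M"
  have \<delta>: "\<delta> > 0"
    using M assms(3) by (simp add: \<delta>_def)
  obtain k h where kh: "\<And>v. v \<in> B \<Longrightarrow> \<bar>of_int k * v - of_int (h v) - t * v / of_int D\<bar> < \<delta>"
    using Kronecker_finite_set[OF fin _ indep \<delta>, of "\<lambda>v. t * v / of_int D"] one rat_real.span_base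
    by blast
  have "\<bar>of_int (D * k) * a - of_int (\<Sum>v\<in>B. N a v * h v) - t * a\<bar> < \<epsilon>" if a: "a \<in> A" for a
  proof -
    have ta: "t * a = (t / of_int D) * (of_int D * a)"
      using D(1) by simp
    have "of_int (D * k) * a - of_int (\<Sum>v\<in>B. N a v * h v) - t * a
        = of_int k * (of_int D * a) - of_int (\<Sum>v\<in>B. N a v * h v) - (t / of_int D) * (of_int D * a)"
      unfolding ta[symmetric] by simp
    also have "\<dots> = (\<Sum>v\<in>B. of_int (N a v) * (of_int k * v - of_int (h v) - t * v / of_int D))"
      unfolding Da[OF a] by (simp add: sum_distrib_left sum_subtractf right_diff_distrib mult_ac)
    also have "\<bar>\<dots>\<bar> \<le> (\<Sum>v\<in>B. \<bar>of_int (N a v)\<bar> * \<delta>)"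
      using less_imp_le[OF kh]
      by (intro order_trans[OF sum_abs] sum_mono) (auto simp: abs_mult intro!: mult_left_mono)
    also have "\<dots> < M * \<delta>"
      using M(2)[OF a] \<delta> by (simp add: sum_distrib_right[symmetric])
    also have "\<dots> = \<epsilon>"
      using M(1) by (simp add: \<delta>_def)
    finally show ?thesis .
  qed
  then show ?thesis by blast
qed

lemma abs_cos_diff_le: "\<bar>cos x - cos y\<bar> \<le> \<bar>x - y :: real\<bar>"
proof -
  have "\<bar>cos x - cos y\<bar> = 2 * \<bar>sin ((x + y) / 2)\<bar> * \<bar>sin ((y - x) / 2)\<bar>"
    by (simp add: cos_diff_cos abs_mult)
  also have "\<dots> \<le> 2 * 1 * \<bar>(y - x) / 2\<bar>"
    by (intro mult_mono abs_sin_x_le_abs_x) auto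
  finally show ?thesis by (simp add: abs_minus_commute)
qed

lemma cos_sum_approximated_at_integer:
  assumes "1 \<notin> rat_span (\<alpha> ` {1..m})" "\<epsilon> > 0"
  shows "\<exists>k::int. cos_sum m b \<alpha> (of_int k) < cos_sum m b \<alpha> t + \<epsilon>"
proof -
  define C where "C = 1 + (\<Sum>j=1..m. \<bar>b j\<bar>)"
  have C: "C > 0"
    by (auto simp: C_def intro!: add_pos_nonneg sum_nonneg)
  define \<delta> where "\<delta> = \<epsilon> / (2 * pi * C)"
  have \<delta>: "\<delta> > 0"
    using C assms(2) by (simp add: \<delta>_def)
  obtain k :: int where
    k: "\<And>j. j \<in> {1..m} \<Longrightarrow> \<exists>h::int. \<bar>of_int k * \<alpha> j - of_int h - t * \<alpha> j\<bar> < \<delta>"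
    using integer_multiples_approximate_real_multiples[OF _ assms(1) \<delta>, of t] by blast
  have close: "\<bar>cos (2 * pi * \<alpha> j * of_int k) - cos (2 * pi * \<alpha> j * t)\<bar> \<le> 2 * pi * \<delta>"
    if j: "j \<in> {1..m}" for j
  proof -
    obtain h :: int where h: "\<bar>of_int k * \<alpha> j - of_int h - t * \<alpha> j\<bar> < \<delta>"
      using k[OF j] by blast
    have "cos (2 * pi * \<alpha> j * of_int k) = cos (2 * pi * (of_int k * \<alpha> j))"
      by (simp add: mult_ac)
    also have "\<dots> = cos (2 * pi * (of_int k * \<alpha> j) - 2 * pi * of_int h)"
      by (simp only: cos_diff cos_int_2pin sin_int_2pin mult_1_right mult_zero_right add_0_right)
    also have "\<dots> = cos (2 * pi * (of_int k * \<alpha> j - of_int h))"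
      by (simp only: right_diff_distrib)
    finally have "\<bar>cos (2 * pi * \<alpha> j * of_int k) - cos (2 * pi * \<alpha> j * t)\<bar>
        \<le> \<bar>2 * pi * (of_int k * \<alpha> j - of_int h) - 2 * pi * \<alpha> j * t\<bar>"
      by (simp only: abs_cos_diff_le)
    also have "\<dots> = \<bar>2 * pi * (of_int k * \<alpha> j - of_int h - t * \<alpha> j)\<bar>"
      by (simp add: algebra_simps)
    also have "\<dots> = 2 * pi * \<bar>of_int k * \<alpha> j - of_int h - t * \<alpha> j\<bar>"
      by (simp add: abs_mult)
    also have "\<dots> \<le> 2 * pi * \<delta>"
      using h by (intro mult_left_mono) auto
    finally show ?thesis .
  qed
  have "cos_sum m b \<alpha> (of_int k) - cos_sum m b \<alpha> t
      = (\<Sum>j=1..m. b j * (cos (2 * pi * \<alpha> j * of_int k) - cos (2 * pi * \<alpha> j * t)))"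
    by (simp add: cos_sum_def sum_subtractf right_diff_distrib)
  also have "\<dots> \<le> (\<Sum>j=1..m. \<bar>b j\<bar> * (2 * pi * \<delta>))"
  proof (rule sum_mono)
    fix j assume "j \<in> {1..m}"
    let ?d = "cos (2 * pi * \<alpha> j * of_int k) - cos (2 * pi * \<alpha> j * t)"
    have "b j * ?d \<le> \<bar>b j\<bar> * \<bar>?d\<bar>"
      using abs_ge_self[of "b j * ?d"] by (simp only: abs_mult)
    also have "\<dots> \<le> \<bar>b j\<bar> * (2 * pi * \<delta>)"
      using close[OF \<open>j \<in> {1..m}\<close>] by (rule mult_left_mono) simp
    finally show "b j * ?d \<le> \<bar>b j\<bar> * (2 * pi * \<delta>)" .
  qed
  also have "\<dots> < C * (2 * pi * \<delta>)"
    using \<delta> by (simp add: sum_distrib_right[symmetric] C_def)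
  also have "\<dots> = \<epsilon>"
    using C by (simp add: \<delta>_def)
  finally show ?thesis
    by (intro exI[of _ k]) simp
qed

theorem theorem4:
  fixes m :: nat and b \<alpha> :: "nat \<Rightarrow> real"
  assumes "m \<ge> 1"
    and "1 \<notin> rat_span (\<alpha> ` {1..m})"
  shows "c_S m b \<alpha> = c_T m b \<alpha>"
proof -
  let ?f = "cos_sum m b \<alpha>"
  have bdd: "bdd_below (range (\<lambda>k::int. ?f (of_int k)))" "bdd_below (range ?f)"
    using cos_sum_lower_bound by (auto intro!: bdd_belowI2)
  have "(INF k::int. ?f (of_int k)) \<le> ?f t" for t
  proof (rule field_le_epsilon)
    fix \<epsilon> :: real assume "\<epsilon> > 0"
    then obtain k :: int where "?f (of_int k) < ?f t + \<epsilon>"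
      using cos_sum_approximated_at_integer[OF assms(2)] by blast
    with cINF_lower[OF bdd(1) UNIV_I, of k] show "(INF k::int. ?f (of_int k)) \<le> ?f t + \<epsilon>"
      by linarith
  qed
  then have "(INF k::int. ?f (of_int k)) \<le> (INF t. ?f t)"
    by (intro cINF_greatest) auto
  moreover have "(INF t. ?f t) \<le> (INF k::int. ?f (of_int k))"
    by (intro cINF_greatest cINF_lower[OF bdd(2)]) auto
  ultimately show ?thesis
    by (simp add: c_S_def c_T_def)
qed

end
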